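(* Let $a,b\in\mathbb{R}$ with $b>a$, let $f\in AC(a,b)$, let $0<\alpha<1$, and put $\omega(\alpha)=-\alpha/(1-\alpha)$. Then, for $t\in(a,b)$, $${}^{CF}\mathbf{D}_{a+}^{\alpha}f(t)=\frac{M(\alpha)}{1-\alpha}\,\mathbf{E}^{1}_{1,1,\omega(\alpha),a+}\,f'(t).$$
   Context: $AC(a,b)$ is the class of absolutely continuous functions on $(a,b)$; for such $f$ the derivative $f'$ exists almost everywhere and $f'\in L^1(a,b)$. The Caputo-Fabrizio (CF) operator of order $\alpha\in(0,1)$ is $${}^{CF}\mathbf{D}_{a+}^{\alpha}f(t)=\frac{M(\alpha)}{1-\alpha}\int_a^t\exp\left[-\frac{\alpha}{1-\alpha}(t-\tau)\right]f'(\tau)\,d\tau,$$ where $M(\alpha)$ is a normalization constant depending on $\alpha$ with $M(0)=M(1)=1$. The Pochhammer symbol is $(\gamma)_0=1$, $(\gamma)_k=\gamma(\gamma+1)\cdots(\gamma+k-1)$ for $k\ge1$. The Prabhakar function is $E^{\gamma}_{\alpha,\beta}(z)=\sum_{k=0}^\infty \frac{(\gamma)_k}{\Gamma(\alpha k+\beta)}\frac{z^k}{k!}$, the Prabhakar kernel is $e^{\gamma}_{\alpha,\beta}(\omega;t)=t^{\beta-1}E^{\gamma}_{\alpha,\beta}(\omega t^\alpha)$, and the Prabhakar fractional integral of $g\in L^1(a,b)$ is $\mathbf{E}^{\gamma}_{\alpha,\beta,\omega,a+}g(t)=\int_a^t e^{\gamma}_{\alpha,\beta}(\omega;t-\tau)\,g(\tau)\,d\tau$.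 In the claim, $\mathbf{E}^{1}_{1,1,\omega(\alpha),a+}f'(t)$ denotes this integral applied to $g=f'$. *)

theory Defs
  imports "HOL-Analysis.Analysis"
begin

text \<open>
  Absolute continuity of a real function on an interval \<open>S\<close> (open or closed), in the usual
  epsilon-delta form; the library's \<open>absolutely_continuous\<close> is about measures.
  Only the values of \<open>f\<close> on \<open>S\<close> matter.
\<close>

definition AC_on :: "real set \<Rightarrow> (real \<Rightarrow> real) \<Rightarrow> bool" where
  "AC_on S f \<longleftrightarrow>
    (\<forall>\<epsilon>>0. \<exists>\<delta>>0. \<forall>(n::nat) (l::nat \<Rightarrow> real) (r::nat \<Rightarrow> real).
      (\<forall>i<n. l i \<le> r i \<and> {l i..r i} \<subseteq> S) \<and>
      disjoint_family_on (\<lambda>i. {l i<..<r i}) {..<n} \<and>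
      (\<Sum>i<n. r i - l i) < \<delta> \<longrightarrow>
      (\<Sum>i<n. \<bar>f (r i) - f (l i)\<bar>) < \<epsilon>)"

text \<open>
  The almost-everywhere derivative of an absolutely continuous function is represented by
  \<^const>\<open>deriv\<close>, whose value at points of non-differentiability is an irrelevant constant:
  these points form a null set, and all integrals below are Lebesgue integrals. The
  normalization function \<open>M\<close> is a parameter.
\<close>

definition CF_deriv :: "(real \<Rightarrow> real) \<Rightarrow> real \<Rightarrow> real \<Rightarrow> (real \<Rightarrow> real) \<Rightarrow> real \<Rightarrow> real" where
  "CF_deriv M \<alpha> a f t =
    M \<alpha> / (1 - \<alpha>) *
      (LINT \<tau>:{a<..<t}|lebesgue. exp (- (\<alpha> / (1 - \<alpha>)) * (t - \<tau>)) * deriv f \<tau>)"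

definition prabhakar_E :: "real \<Rightarrow> real \<Rightarrow> real \<Rightarrow> real \<Rightarrow> real" where
  "prabhakar_E \<gamma> \<alpha> \<beta> z =
    (\<Sum>k. pochhammer \<gamma> k / Gamma (\<alpha> * real k + \<beta>) * (z ^ k / fact k))"

text \<open>
  The kernel is meant for \<open>t > 0\<close>. Since \<open>0 powr x = 0\<close>, its value at \<open>t = 0\<close> is a
  convention; it is never reached under the integral over the open interval below.
\<close>

definition prabhakar_kernel :: "real \<Rightarrow> real \<Rightarrow> real \<Rightarrow> real \<Rightarrow> real \<Rightarrow> real" where
  "prabhakar_kernel \<gamma> \<alpha> \<beta> \<omega> t = t powr (\<beta> - 1) * prabhakar_E \<gamma> \<alpha> \<beta> (\<omega> * t powr \<alpha>)"

definition prabhakar_integral ::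
    "real \<Rightarrow> real \<Rightarrow> real \<Rightarrow> real \<Rightarrow> real \<Rightarrow> (real \<Rightarrow> real) \<Rightarrow> real \<Rightarrow> real" where
  "prabhakar_integral \<gamma> \<alpha> \<beta> \<omega> a g t =
    (LINT \<tau>:{a<..<t}|lebesgue. prabhakar_kernel \<gamma> \<alpha> \<beta> \<omega> (t - \<tau>) * g \<tau>)"

end

theory Submission
  imports Defs
begin

text \<open>With all three parameters equal to 1, the Pochhammer symbol and the Gamma value in each
  coefficient are both k! and cancel. The Prabhakar series becomes the exponential series, and for
  this \<omega> its kernel is the Caputo-Fabrizio kernel.\<close>

lemma prabhakar_E_1_1_1: "prabhakar_E 1 1 1 z = exp z"
proof -
  have "pochhammer 1 k / Gamma (1 * real k + 1) * (z ^ k / fact k) = z ^ k /\<^sub>R fact k" for k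
    using Gamma_fact[of k, where 'a = real]
    by (simp add: pochhammer_fact[symmetric] add.commute field_simps)
  then show ?thesis
    by (simp add: prabhakar_E_def exp_def)
qed

text \<open>Positivity matters: at \<open>t = 0\<close> the factor \<open>t powr 0\<close> is 0,
  whereas the exponential is 1.\<close>

lemma prabhakar_kernel_1_1_1:
  assumes "0 < t"
  shows "prabhakar_kernel 1 1 1 \<omega> t = exp (\<omega> * t)"
  using assms by (simp add: prabhakar_kernel_def prabhakar_E_1_1_1)

lemma prabhakar_integral_1_1_1:
  "prabhakar_integral 1 1 1 \<omega> a g t = (LINT \<tau>:{a<..<t}|lebesgue. exp (\<omega> * (t - \<tau>)) * g \<tau>)"
  unfolding prabhakar_integral_def
  \<comment> \<open>On the open interval \<open>t - \<tau>\<close> is positive, so the integrands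
    agree pointwise.\<close>
  by (rule set_lebesgue_integral_cong) (auto simp: prabhakar_kernel_1_1_1)

theorem theorem2:
  fixes a b \<alpha> \<omega> t :: real and f M :: "real \<Rightarrow> real"
  assumes "a < b"
    and "AC_on {a<..<b} f"
    and "0 < \<alpha>" and "\<alpha> < 1"
    and "M 0 = 1" and "M 1 = 1"
    and "\<omega> = - \<alpha> / (1 - \<alpha>)"
    and "t \<in> {a<..<b}"
  shows "CF_deriv M \<alpha> a f t = M \<alpha> / (1 - \<alpha>) * prabhakar_integral 1 1 1 \<omega> a (deriv f) t"
  using assms(7) by (simp add: CF_deriv_def prabhakar_integral_1_1_1)

end
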